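(* Let $\pi$ be a noncrossing partition of $[n]$. Then $$\mu_{\mathcal{NCP}}(\pi)=(-1)^{|\pi|}\prod_{C\in\pi/\sim_\pi}\mathrm{cat}_{|C|},$$ where the product runs over the equivalence classes $C$ of $\sim_\pi$ and $|C|$ is the number of blocks in $C$.
   Context: $\mathbb{K}$ is a field of characteristic zero. $\mathrm{cat}_n=\frac{1}{n+1}\binom{2n}{n}$ is the $n$-th Catalan number. A noncrossing partition is a partition $\pi$ of a set $[n]=\{1,\ldots,n\}$, $n\ge1$, into nonempty blocks such that there are no distinct blocks $b\ne b'$ and $x,z\in b$, $y,t\in b'$ with $x<y<z<t$. $|\pi|$ is its number of blocks; $\mathcal{NCP}$ is the set of all noncrossing partitions. The equivalence $\sim_\pi$ on the set of blocks of $\pi$: $b\sim_\pi b'$ if there is a sequence $(b_1,\ldots,b_k)$ of blocks of $\pi$ with $\{b_1,b_k\}=\{b,b'\}$ (i.e. $b_1=b,b_k=b'$ or $b_1=b',b_k=b$) and $\max(b_i)+1=\min(b_{i+1})$ for all $1\le i\le k-1$. For a nonempty set $Y$ of blocks of $\pi$, $\pi_{\mid Y}$ is the noncrossing partition obtained by deleting the blocks not in $Y$ and renumbering the remaining elements increasingly; $\pi_{\mid\emptyset}=1$. The nesting order on blocks is $b\le_\pi b'\iff b'\subseteq[\min b,\max b]$. An ideal of $\pi$ is a set $J$ of blocks that is upward closed for $\le_\pi$; then the union of its blocks decomposes into maximal subsets of consecutive integers $I_1,\ldots,I_k$, each a union of blocks, and $\pi_{\mid_\cdot J}=\prod_i\pi_{\mid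 I_i}$ (restriction to the blocks contained in $I_i$; product $\cdot$ below). $\mathbb{K}[\mathcal{NCP}]$ is the free commutative algebra generated by $\mathcal{NCP}$, with product $\cdot$ and unit $1$. It carries two coproducts which are algebra morphisms, given on $\pi\in\mathcal{NCP}$ by $\Delta(\pi)=\sum_{J\text{ ideal of }\pi}\pi_{\mid\pi\setminus J}\otimes\pi_{\mid_\cdot J}$ and $\delta(\pi)=\sum_{\sim\in\mathcal{E}_c[\pi]}\pi/\!\sim\,\otimes\,\pi\mid_\cdot\sim$, where, for an equivalence $\sim$ on the set of blocks of $\pi$, $\pi/\!\sim$ is the partition whose blocks are the unions of the blocks in each class, $\mathcal{E}_c[\pi]$ is the set of $\sim$ for which $\pi/\!\sim$ is noncrossing, and $\pi\mid_\cdot\sim=\prod_{C\text{ class of }\sim}\pi_{\mid C}$. The counits are the algebra morphisms with $\varepsilon_\Delta(\pi)=0$, and $\epsilon_\delta(\pi)=1$ if $|\pi|=1$, $\epsilon_\delta(\pi)=0$ otherwise. $\mathbb{K}[X]$ has the multiplicative coproducts $\Delta(X)=X\otimes1+1\otimes X$, $\delta(X)=X\otimes X$ with counits $P\mapsto P(0)$, $P\mapsto P(1)$. $\phi_{\mathcal{NCP}}:\mathbb{K}[\mathcal{NCP}]\to\mathbb{K}[X]$ is the unique algebra morphism compatible with both coproducts $\Delta,\delta$ and both counits. By known results it exists, is unique, and for $x\in\ker\varepsilon_\Delta$, $\phi_{\mathcal{NCP}}(x)=\sum_{k\ge1}\epsilon_\delta^{\otimes k}\circ\tilde\Delta^{(k-1)}(x)\,H_k(X)$,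 with $\tilde\Delta(x)=\Delta(x)-x\otimes1-1\otimes x$, $\tilde\Delta^{(k-1)}$ its iterates ($\tilde\Delta^{(0)}=\mathrm{Id}$), and $H_k(X)=X(X-1)\cdots(X-k+1)/k!$. The character $\mu_{\mathcal{NCP}}:\mathbb{K}[\mathcal{NCP}]\to\mathbb{K}$ is defined by $\mu_{\mathcal{NCP}}(x)=\phi_{\mathcal{NCP}}(x)(-1)$. *)

theory Defs
  imports
    "HOL-Library.Poly_Mapping"
    "HOL-Library.Product_Plus"
    "HOL-Library.Multiset"
    "HOL-Library.Disjoint_Sets"
    "HOL-Computational_Algebra.Polynomial"
begin

section \<open>Noncrossing partitions\<close>

definition noncrossing :: "nat set set \<Rightarrow> bool" where
  "noncrossing P \<longleftrightarrow>
     \<not> (\<exists>b\<in>P. \<exists>b'\<in>P. b \<noteq> b' \<and>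
          (\<exists>x\<in>b. \<exists>z\<in>b. \<exists>y\<in>b'. \<exists>t\<in>b'. x < y \<and> y < z \<and> z < t))"

definition noncrossing_partition :: "nat \<Rightarrow> nat set set \<Rightarrow> bool" where
  "noncrossing_partition n P \<longleftrightarrow> 1 \<le> n \<and> partition_on {1..n} P \<and> noncrossing P"

typedef ncp = "{P. \<exists>n. noncrossing_partition n P}"
  morphisms blocks Abs_ncp
proof -
  have "noncrossing_partition 1 {{1}}"
    by (auto simp: noncrossing_partition_def noncrossing_def partition_on_def)
  then show ?thesis by blast
qed

text \<open>\<open>renumber Y\<close> transports a set of blocks along the increasing bijection from its union
  onto an initial segment \<open>{1..k}\<close>.\<close>

definition renumber :: "nat set set \<Rightarrow> nat set set" where
  "renumber Y = (\<lambda>b. (\<lambda>x. card {y \<in> \<Union>Y. y \<le> x}) ` b) ` Y"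

text \<open>Monomials in noncrossing partitions are multisets; \<open>{#}\<close> is the unit \<open>1\<close>. The restriction
  of \<open>\<pi>\<close> to a set \<open>Y\<close> of its blocks is a monomial, because it is \<open>1\<close> when \<open>Y\<close> is empty.\<close>

definition restrict_blocks :: "nat set set \<Rightarrow> ncp multiset" where
  "restrict_blocks Y = (if Y = {} then {#} else {#Abs_ncp (renumber Y)#})"

definition nest_le :: "nat set \<Rightarrow> nat set \<Rightarrow> bool" where
  "nest_le b b' \<longleftrightarrow> b' \<subseteq> {Min b..Max b}"

definition is_ideal :: "ncp \<Rightarrow> nat set set \<Rightarrow> bool" where
  "is_ideal \<pi> J \<longleftrightarrow> J \<subseteq> blocks \<pi> \<and>
     (\<forall>b\<in>J. \<forall>b'\<in>blocks \<pi>. nest_le b b' \<longrightarrow> b' \<in> J)"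

definition runs :: "nat set \<Rightarrow> nat set set" where
  "runs U = {I. (\<exists>a b. a \<le> b \<and> I = {a..b}) \<and> I \<subseteq> U \<and>
                (\<forall>a b. I \<subseteq> {a..b} \<and> {a..b} \<subseteq> U \<longrightarrow> {a..b} = I)}"

definition restrict_ideal :: "nat set set \<Rightarrow> ncp multiset" where
  "restrict_ideal J = (\<Sum>I\<in>runs (\<Union>J). restrict_blocks {b \<in> J. b \<subseteq> I})"

definition quotient_blocks :: "ncp \<Rightarrow> (nat set \<times> nat set) set \<Rightarrow> nat set set" where
  "quotient_blocks \<pi> R = \<Union> ` (blocks \<pi> // R)"

definition contractions :: "ncp \<Rightarrow> (nat set \<times> nat set) set set" where
  "contractions \<pi> = {R. equiv (blocks \<pi>) R \<and> noncrossing (quotient_blocks \<pi> R)}"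

definition restrict_classes :: "ncp \<Rightarrow> (nat set \<times> nat set) set \<Rightarrow> ncp multiset" where
  "restrict_classes \<pi> R = (\<Sum>C\<in>blocks \<pi> // R. restrict_blocks C)"

definition chain_rel :: "ncp \<Rightarrow> (nat set \<times> nat set) set" where
  "chain_rel \<pi> = {(b, b'). \<exists>bs. bs \<noteq> [] \<and> set bs \<subseteq> blocks \<pi> \<and>
      (hd bs = b \<and> last bs = b' \<or> hd bs = b' \<and> last bs = b) \<and>
      (\<forall>i. Suc i < length bs \<longrightarrow> Max (bs ! i) + 1 = Min (bs ! Suc i))}"

definition catalan :: "nat \<Rightarrow> 'k::field_char_0" where
  "catalan n = 1 / of_nat (n + 1) * of_nat ((2 * n) choose n)"

section \<open>The free commutative algebra on noncrossing partitions\<close>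

text \<open>This algebra is the monoid algebra of the free commutative monoid of monomials, and its tensor
  square is the monoid algebra of pairs of monomials, the pair \<open>(m, m')\<close> standing
  for \<open>m \<otimes> m'\<close>.\<close>

type_synonym 'k ncp_alg = "ncp multiset \<Rightarrow>\<^sub>0 'k"
type_synonym 'k ncp_alg2 = "(ncp multiset \<times> ncp multiset) \<Rightarrow>\<^sub>0 'k"

definition gen :: "ncp \<Rightarrow> 'k::comm_ring_1 ncp_alg" where
  "gen \<pi> = Poly_Mapping.single {#\<pi>#} 1"

definition pure2 :: "ncp multiset \<Rightarrow> ncp multiset \<Rightarrow> 'k::comm_ring_1 ncp_alg2" where
  "pure2 m m' = Poly_Mapping.single (m, m') 1"

text \<open>The extension of a map \<open>g\<close> on generators to an algebra morphism into the algebra with structure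
  map \<open>\<iota>\<close>.\<close>

definition alg_lift :: "('k \<Rightarrow> 'b) \<Rightarrow> (ncp \<Rightarrow> 'b) \<Rightarrow> 'k::comm_ring_1 ncp_alg \<Rightarrow> 'b::comm_ring_1" where
  "alg_lift \<iota> g x =
     (\<Sum>m\<in>Poly_Mapping.keys x. \<iota> (Poly_Mapping.lookup x m) * (\<Prod>\<pi>\<in>#m. g \<pi>))"

definition Delta_ncp :: "'k::comm_ring_1 ncp_alg \<Rightarrow> 'k ncp_alg2" where
  "Delta_ncp = alg_lift (Poly_Mapping.single 0)
     (\<lambda>\<pi>. \<Sum>J | is_ideal \<pi> J. pure2 (restrict_blocks (blocks \<pi> - J)) (restrict_ideal J))"

definition delta_ncp :: "'k::comm_ring_1 ncp_alg \<Rightarrow> 'k ncp_alg2" where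
  "delta_ncp = alg_lift (Poly_Mapping.single 0)
     (\<lambda>\<pi>. \<Sum>R\<in>contractions \<pi>.
        pure2 {#Abs_ncp (quotient_blocks \<pi> R)#} (restrict_classes \<pi> R))"

definition counit_Delta :: "'k::comm_ring_1 ncp_alg \<Rightarrow> 'k" where
  "counit_Delta = alg_lift id (\<lambda>\<pi>. 0)"

definition counit_delta :: "'k::comm_ring_1 ncp_alg \<Rightarrow> 'k" where
  "counit_delta = alg_lift id (\<lambda>\<pi>. if card (blocks \<pi>) = 1 then 1 else 0)"

section \<open>The polynomial algebra and its coproducts\<close>

text \<open>The tensor square of \<open>K[X]\<close> is the type of polynomials over \<open>K[X]\<close>: the outer
  variable is \<open>X \<otimes> 1\<close>, the inner one is \<open>1 \<otimes> X\<close>.\<close>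

definition tensor_poly :: "'k::comm_ring_1 poly \<Rightarrow> 'k poly \<Rightarrow> 'k poly poly" where
  "tensor_poly P Q = map_poly (\<lambda>c. [:c:]) P * [:Q:]"

definition Delta_poly :: "'k::comm_ring_1 poly \<Rightarrow> 'k poly poly" where
  "Delta_poly P = pcompose (tensor_poly P 1) (tensor_poly [:0, 1:] 1 + tensor_poly 1 [:0, 1:])"

definition delta_poly :: "'k::comm_ring_1 poly \<Rightarrow> 'k poly poly" where
  "delta_poly P = pcompose (tensor_poly P 1) (tensor_poly [:0, 1:] [:0, 1:])"

section \<open>Morphisms of double bialgebras\<close>

definition alg_morphism :: "('k::comm_ring_1 ncp_alg \<Rightarrow> 'k poly) \<Rightarrow> bool" where
  "alg_morphism \<phi> \<longleftrightarrow>
     (\<forall>x y. \<phi> (x + y) = \<phi> x + \<phi> y) \<and>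
     (\<forall>x y. \<phi> (x * y) = \<phi> x * \<phi> y) \<and>
     (\<forall>c. \<phi> (Poly_Mapping.single 0 c) = [:c:])"

text \<open>\<open>\<phi> \<otimes> \<phi>\<close>, for a linear map \<open>\<phi>\<close>.\<close>

definition tensor_map ::
    "('k::comm_ring_1 ncp_alg \<Rightarrow> 'k poly) \<Rightarrow> 'k ncp_alg2 \<Rightarrow> 'k poly poly" where
  "tensor_map \<phi> t =
     (\<Sum>(m, m')\<in>Poly_Mapping.keys t. smult [:Poly_Mapping.lookup t (m, m'):]
        (tensor_poly (\<phi> (Poly_Mapping.single m 1)) (\<phi> (Poly_Mapping.single m' 1))))"

definition double_bialgebra_morphism :: "('k::comm_ring_1 ncp_alg \<Rightarrow> 'k poly) \<Rightarrow> bool" where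
  "double_bialgebra_morphism \<phi> \<longleftrightarrow>
     alg_morphism \<phi> \<and>
     (\<forall>x. Delta_poly (\<phi> x) = tensor_map \<phi> (Delta_ncp x)) \<and>
     (\<forall>x. delta_poly (\<phi> x) = tensor_map \<phi> (delta_ncp x)) \<and>
     (\<forall>x. poly (\<phi> x) 0 = counit_Delta x) \<and>
     (\<forall>x. poly (\<phi> x) 1 = counit_delta x)"

definition mu_ncp :: "('k::comm_ring_1 ncp_alg \<Rightarrow> 'k poly) \<Rightarrow> 'k ncp_alg \<Rightarrow> 'k" where
  "mu_ncp \<phi> x = poly (\<phi> x) (- 1)"

end

theory Submission
  imports Defs
begin

text \<open>
  Write \<open>\<mu>(\<pi>)\<close> for the value of \<open>\<phi>(\<pi>)\<close> at \<open>-1\<close>. Compatibility of \<open>\<phi>\<close> with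
  \<open>\<Delta>\<close>, evaluated at \<open>(1, -1)\<close>, gives
  \<open>0 = \<phi>(\<pi>)(0) = \<Sum>J. \<phi>(\<pi> - J)(1) \<mu>(J)\<close>, where \<open>J\<close> runs over the ideals and
  \<open>\<mu>(J)\<close> is the product of \<open>\<mu>\<close> over the maximal intervals in the union of \<open>J\<close>. Since
  evaluation at \<open>1\<close> is the counit of \<open>\<delta>\<close>, the first factor vanishes unless \<open>\<pi> - J\<close> has
  at most one block, in which case it is one, and a single block is the complement of an ideal exactly if it is not nested in another
  block, that is, if it is an outer block. So \<open>\<mu>(\<pi>) = - (\<Sum>b. \<mu>(\<pi> - b))\<close> over the outer
  blocks \<open>b\<close>. Together with the value on the empty monomial this determines \<open>\<mu>\<close>
  by induction on the number of blocks.

  The claimed value, called the weight below, satisfies the same recursion. The outer blocks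
  \<open>b\<^sub>1, ..., b\<^sub>k\<close> tile \<open>{1..n}\<close> by their hulls and form one class of the chain relation; all other
  classes consist of blocks nested in outer ones. Removing \<open>b\<^sub>i\<close> cuts the class of the outer
  blocks into chains of lengths \<open>i - 1\<close> and \<open>k - i\<close> and leaves the other classes alone
  (\<open>weight_remove_outer\<close>), so the recursion for the weight is the Catalan recursion
  \<open>\<Sum>i. cat (i - 1) cat (k - i) = cat k\<close> (\<open>weight_recursion\<close>). The weight is multiplicative
  over maximal intervals because no chain connects different ones (\<open>runs_remove_outer\<close>), and it
  is unchanged by renumbering an interval, which is a shift (\<open>weight_renumber_interval\<close>).
\<close>

section \<open>The Catalan recursion\<close>

lemma catalan_0: "catalan 0 = 1"
  by (simp add: catalan_def)

lemma catalan_Suc_ratio: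
  "of_nat (n + 2) * (catalan (Suc n) :: 'k::field_char_0) = of_nat (4 * n + 2) * catalan n"
proof -
  have 1: "Suc n * ((2 * n + 2) choose Suc n) = (2 * n + 2) * ((2 * n + 1) choose n)"
    using Suc_times_binomial_eq[of "2 * n + 1" n] by (simp add: mult.commute)
  have "(2 * n + 1) choose n = (2 * n + 1) choose Suc n"
    using binomial_symmetric[of n "2 * n + 1"] by simp
  hence 2: "Suc n * ((2 * n + 1) choose n) = (2 * n + 1) * ((2 * n) choose n)"
    using Suc_times_binomial_eq[of "2 * n" n] by (simp add: mult.commute)
  have "Suc n * ((2 * n + 2) choose Suc n) = 2 * (Suc n * ((2 * n + 1) choose n))"
    using 1 by simp
  hence "Suc n * ((2 * n + 2) choose Suc n) = (4 * n + 2) * ((2 * n) choose n)"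
    using 2 by simp
  hence "(of_nat (Suc n) :: 'k) * of_nat ((2 * n + 2) choose Suc n) = of_nat (4 * n + 2) * of_nat ((2 * n) choose n)"
    by (metis of_nat_mult)
  moreover have "(of_nat (Suc n) :: 'k) \<noteq> 0" "(of_nat (n + 2) :: 'k) \<noteq> 0"
    by (simp_all only: of_nat_eq_0_iff)
  ultimately show ?thesis
    unfolding catalan_def by (simp add: field_simps del: of_nat_Suc of_nat_add)
qed

text \<open>Write \<open>S\<^sub>n\<close> for the convolution. Reversing the sum gives \<open>2 (\<Sum>i. i C\<^sub>i C\<^sub>n\<^sub>-\<^sub>i) = n S\<^sub>n\<close>. In
\<open>\<Sum>i. (i + 1) C\<^sub>i C\<^sub>n\<^sub>+\<^sub>1\<^sub>-\<^sub>i\<close> the ratio of consecutive Catalan numbers lowers the index of the first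
factor, and combining the two gives \<open>(n + 3) S\<^sub>n\<^sub>+\<^sub>1 = 2 C\<^sub>n\<^sub>+\<^sub>1 + 4 (n + 1) S\<^sub>n\<close>. With
\<open>S\<^sub>n = C\<^sub>n\<^sub>+\<^sub>1\<close> the same ratio identifies the right-hand side as \<open>(n + 3) C\<^sub>n\<^sub>+\<^sub>2\<close>.\<close>

lemma catalan_convolution:
  "(\<Sum>i\<le>n. catalan i * catalan (n - i)) = (catalan (Suc n) :: 'k::field_char_0)"
proof (induction n)
  case 0
  show ?case using catalan_Suc_ratio[of 0, where 'k = 'k] by (simp add: catalan_0)
next
  case (Suc n)
  let ?c = "catalan :: nat \<Rightarrow> 'k"
  define S where "S m = (\<Sum>i\<le>m. ?c i * ?c (m - i))" for m
  define T where "T m = (\<Sum>i\<le>m. of_nat i * (?c i * ?c (m - i)))" for m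
  have T: "2 * T m = of_nat m * S m" for m
  proof -
    have "T m = (\<Sum>i\<le>m. of_nat (m - i) * (?c i * ?c (m - i)))"
      unfolding T_def by (rule sum.reindex_bij_witness[of _ "\<lambda>i. m - i" "\<lambda>i. m - i"]) (auto simp: mult.commute)
    hence "2 * T m = T m + (\<Sum>i\<le>m. of_nat (m - i) * (?c i * ?c (m - i)))"
      by (metis mult_2)
    also have "\<dots> = (\<Sum>i\<le>m. (of_nat i + of_nat (m - i)) * (?c i * ?c (m - i)))"
      unfolding T_def by (simp only: sum.distrib distrib_right)
    also have "\<dots> = of_nat m * S m"
      unfolding S_def sum_distrib_left
      by (intro sum.cong refl) (simp add: of_nat_diff)
    finally show ?thesis .
  qed
  have "T (Suc n) + S (Suc n) = (\<Sum>i\<le>Suc n. of_nat (i + 1) * (?c i * ?c (Suc n - i)))"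
    by (simp add: T_def S_def sum.distrib[symmetric] algebra_simps del: sum.atMost_Suc)
  also have "\<dots> = ?c (Suc n) + (\<Sum>i\<le>n. (of_nat (i + 2) * ?c (Suc i)) * ?c (n - i))"
    by (subst sum.atMost_Suc_shift) (simp add: catalan_0 mult.assoc)
  also have "(\<Sum>i\<le>n. (of_nat (i + 2) * ?c (Suc i)) * ?c (n - i)) = 4 * T n + 2 * S n"
    unfolding catalan_Suc_ratio T_def S_def
    by (simp add: sum_distrib_left sum.distrib[symmetric] algebra_simps)
  finally have "2 * (T (Suc n) + S (Suc n)) = 2 * (?c (Suc n) + (4 * T n + 2 * S n))" by simp
  hence "of_nat (n + 3) * S (Suc n) = 2 * ?c (Suc n) + of_nat (4 * n + 4) * S n"
    using T[of "Suc n"] T[of n] by (simp add: algebra_simps)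
  also have "S n = ?c (Suc n)" using Suc by (simp add: S_def)
  also have "2 * ?c (Suc n) + of_nat (4 * n + 4) * ?c (Suc n) = of_nat (Suc n + 2) * ?c (Suc (Suc n))"
    unfolding catalan_Suc_ratio by (simp add: algebra_simps)
  finally have "of_nat (n + 3) * S (Suc n) = of_nat (n + 3) * ?c (Suc (Suc n))" by simp
  moreover have "(of_nat (n + 3) :: 'k) \<noteq> 0" by (simp only: of_nat_eq_0_iff)
  ultimately show ?case unfolding S_def by simp
qed

text \<open>The number of smaller elements is a bijection from \<open>S\<close> onto an initial segment. With it
the sum over outer blocks becomes a convolution once each block is known by how many outer blocks
lie to its left and to its right.\<close>

lemma sum_rank_eq:
  fixes S :: "'a::linorder set"
  assumes "finite S"
  shows "(\<Sum>x\<in>S. f (card {y\<in>S. y < x}) (card {y\<in>S. x < y})) = (\<Sum>i<card S. f i (card S - Suc i))"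
proof -
  let ?r = "\<lambda>x. card {y\<in>S. y < x}"
  have mono: "?r x < ?r y" if "x \<in> S" "y \<in> S" "x < y" for x y
    using that assms by (intro psubset_card_mono) auto
  have inj: "inj_on ?r S"
  proof (rule inj_onI)
    fix x y assume "x \<in> S" "y \<in> S" "?r x = ?r y"
    then show "x = y" using mono[of x y] mono[of y x] by (cases x y rule: linorder_cases) auto
  qed
  have "?r x < card S" if "x \<in> S" for x
    using that assms by (intro psubset_card_mono) auto
  hence "?r ` S \<subseteq> {..<card S}" by auto
  hence img: "?r ` S = {..<card S}"
    by (intro card_subset_eq) (auto simp: card_image inj)
  have up: "card {y\<in>S. x < y} = card S - Suc (?r x)" if "x \<in> S" for x
  proof -
    have "S = {y\<in>S. y < x} \<union> {x} \<union> {y\<in>S. x < y}" using that by auto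
    hence "card S = card ({y\<in>S. y < x} \<union> {x} \<union> {y\<in>S. x < y})" by (rule arg_cong)
    also have "\<dots> = ?r x + 1 + card {y\<in>S. x < y}"
      using assms by (subst card_Un_disjoint, simp, simp, force)+ simp
    finally show ?thesis by simp
  qed
  show ?thesis
    by (simp add: sum.reindex[OF inj] up flip: img)
qed

section \<open>Chains of adjacent blocks and their weight\<close>

definition link :: "nat set set \<Rightarrow> (nat set \<times> nat set) set" where
  "link P = {(b, c). b \<in> P \<and> c \<in> P \<and> (Max b + 1 = Min c \<or> Max c + 1 = Min b)}"

text \<open>The weights below are taken of arbitrary sets of blocks, not only of partitions of an initial
segment, so that the recursion for the weight involves no renumbering. Taking the
equivalence closure of adjacency makes symmetry and locality immediate.\<close>

definition chained :: "nat set set \<Rightarrow> (nat set \<times> nat set) set" where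
  "chained P = (link P)\<^sup>* \<inter> P \<times> P"

text \<open>The right-hand side of the theorem, for an arbitrary set of blocks.\<close>

definition weight :: "nat set set \<Rightarrow> 'k::field_char_0" where
  "weight P = (- 1) ^ card P * (\<Prod>C\<in>P // chained P. catalan (card C))"

definition unlinked :: "nat set set \<Rightarrow> nat set set \<Rightarrow> bool" where
  "unlinked P Q \<longleftrightarrow> (\<forall>b\<in>P. \<forall>c\<in>Q. Max b + 1 \<noteq> Min c \<and> Max c + 1 \<noteq> Min b)"

lemma unlinked_sym: "unlinked P Q \<Longrightarrow> unlinked Q P"
  by (auto simp: unlinked_def)

lemma refl_chained: "b \<in> P \<Longrightarrow> (b, b) \<in> chained P"
  by (auto simp: chained_def)

lemma sym_link: "sym (link P)"
  by (auto simp: link_def sym_def)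

text \<open>Adjacency is decided by the two blocks alone, so a chain cannot leave a set of blocks that has no
neighbour outside.\<close>

lemma chained_unlinked_Un:
  assumes "unlinked P Q" "b \<in> P" "P \<inter> Q = {}"
  shows "chained (P \<union> Q) `` {b} = chained P `` {b}"
proof -
  have "c \<in> P \<and> (b, c) \<in> (link P)\<^sup>*" if "(b, c) \<in> (link (P \<union> Q))\<^sup>*" for c
    using that
  proof induction
    case base
    then show ?case using assms by auto
  next
    case (step c d)
    hence "(c, d) \<in> link P" using assms by (auto simp: link_def unlinked_def)
    then show ?case using step rtrancl_into_rtrancl[of b c "link P" d] by (auto simp: link_def[of P])
  qed
  moreover have "(link P)\<^sup>* \<subseteq> (link (P \<union> Q))\<^sup>*"
    by (rule rtrancl_mono) (auto simp: link_def)
  ultimately show ?thesis by (auto simp: chained_def)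
qed

lemma weight_Un:
  assumes "unlinked P Q" "P \<inter> Q = {}" "finite P" "finite Q"
  shows "weight (P \<union> Q) = weight P * weight Q"
proof -
  have "(P \<union> Q) // chained (P \<union> Q) = P // chained P \<union> Q // chained Q"
    using chained_unlinked_Un[of P Q] chained_unlinked_Un[of Q P] assms(1,2) unlinked_sym[of P Q]
    by (auto simp: quotient_def Un_commute Int_commute)
  moreover have "P // chained P \<inter> Q // chained Q = {}"
  proof -
    have "{} \<noteq> C \<and> C \<subseteq> P" if "C \<in> P // chained P" for C P
      using that refl_chained by (fastforce simp: quotient_def chained_def)
    from this[of _ P] this[of _ Q] show ?thesis using assms(2) by blast
  qed
  moreover have "finite (P // chained P)" "finite (Q // chained Q)"
    using assms by (auto simp: quotient_def)
  ultimately show ?thesis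
    using assms by (simp add: weight_def prod.union_disjoint card_Un_disjoint power_add)
qed

lemma weight_empty: "weight {} = 1"
  by (simp add: weight_def quotient_def)

lemma weight_UN:
  assumes "finite A" "\<And>i. i \<in> A \<Longrightarrow> finite (F i)"
    and "\<And>i j. i \<in> A \<Longrightarrow> j \<in> A \<Longrightarrow> i \<noteq> j \<Longrightarrow> unlinked (F i) (F j) \<and> F i \<inter> F j = {}"
  shows "weight (\<Union>i\<in>A. F i) = (\<Prod>i\<in>A. weight (F i) :: 'k::field_char_0)"
  using assms
proof (induction A)
  case empty
  then show ?case by (simp add: weight_empty)
next
  case (insert i A)
  have "unlinked (F i) (\<Union>j\<in>A. F j)" "F i \<inter> (\<Union>j\<in>A. F j) = {}"
    using insert.prems(2)[of i] insert.hyps by (auto simp: unlinked_def)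
  hence "weight (F i \<union> (\<Union>j\<in>A. F j)) = weight (F i) * (weight (\<Union>j\<in>A. F j) :: 'k)"
    using insert by (intro weight_Un) auto
  then show ?case using insert by auto
qed

lemma weight_total:
  assumes "finite S" "\<And>b c. b \<in> S \<Longrightarrow> c \<in> S \<Longrightarrow> (b, c) \<in> chained S"
  shows "weight S = (- 1) ^ card S * catalan (card S)"
proof (cases "S = {}")
  case True
  then show ?thesis by (simp add: weight_empty catalan_0)
next
  case False
  have "chained S `` {b} = S" if "b \<in> S" for b
    using assms that by (auto simp: chained_def)
  hence "S // chained S = {S}" using False by (auto simp: quotient_def)
  then show ?thesis by (simp add: weight_def)
qed

text \<open>Only the adjacencies matter for chains; this is what makes the weight insensitive to a shift.\<close>

lemma chained_image:
  assumes "inj_on f P"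
    and "\<And>b c. b \<in> P \<Longrightarrow> c \<in> P \<Longrightarrow> Max (f b) + 1 = Min (f c) \<longleftrightarrow> Max b + 1 = Min c"
  shows "chained (f ` P) = map_prod f f ` chained P"
proof -
  have L: "link (f ` P) = map_prod f f ` link P"
    using assms(2) by (auto simp: link_def image_iff map_prod_def) 
  have fw: "(f b, f c) \<in> (link (f ` P))\<^sup>*" if "(b, c) \<in> (link P)\<^sup>*" for b c
    using that
  proof induction
    case (step y z)
    hence "(f y, f z) \<in> link (f ` P)" unfolding L by force
    then show ?case using step by (meson rtrancl.simps)
  qed simp
  have bw: "\<exists>c\<in>P. v = f c \<and> (b, c) \<in> (link P)\<^sup>*"
    if "(f b, v) \<in> (link (f ` P))\<^sup>*" "b \<in> P" for b v
    using that
  proof (induction)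
    case base
    then show ?case by auto
  next
    case (step y z)
    then obtain c where c: "c \<in> P" "y = f c" "(b, c) \<in> (link P)\<^sup>*" by auto
    from step(2) obtain c' d where d: "(c', d) \<in> link P" "y = f c'" "z = f d" unfolding L by auto
    have "c' = c" using d c assms(1) by (auto simp: link_def inj_on_def)
    then show ?case using c d by (auto simp: link_def intro: rtrancl_into_rtrancl)
  qed
  show ?thesis
  proof (intro set_eqI iffI)
    fix q assume "q \<in> chained (f ` P)"
    then obtain b v where "q = (f b, v)" "b \<in> P" "(f b, v) \<in> (link (f ` P))\<^sup>*"
      by (auto simp: chained_def)
    then obtain c where "q = map_prod f f (b, c)" "b \<in> P" "c \<in> P" "(b, c) \<in> (link P)\<^sup>*"
      using bw[of b v] by auto
    then show "q \<in> map_prod f f ` chained P" unfolding chained_def by blast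
  next
    fix q assume "q \<in> map_prod f f ` chained P"
    then show "q \<in> chained (f ` P)" using fw by (auto simp: chained_def)
  qed
qed

lemma weight_image:
  assumes "inj_on f P"
    and "\<And>b c. b \<in> P \<Longrightarrow> c \<in> P \<Longrightarrow> Max (f b) + 1 = Min (f c) \<longleftrightarrow> Max b + 1 = Min c"
  shows "weight (f ` P) = weight P"
proof -
  have cl: "chained (f ` P) `` {f b} = f ` (chained P `` {b})" if "b \<in> P" for b
  proof (intro set_eqI iffI)
    fix v assume "v \<in> chained (f ` P) `` {f b}"
    then have "(f b, v) \<in> map_prod f f ` chained P"
      by (simp only: Image_singleton_iff chained_image[OF assms])
    then obtain b' c where "(b', c) \<in> chained P" "f b' = f b" "v = f c"
      by (force simp: image_iff)
    moreover from this have "b' = b" using that assms(1) by (auto simp: chained_def inj_on_def)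
    ultimately show "v \<in> f ` (chained P `` {b})" by auto
  next
    fix v assume "v \<in> f ` (chained P `` {b})"
    then obtain c where "(b, c) \<in> chained P" "v = f c" by auto
    then have "(f b, v) \<in> map_prod f f ` chained P" by force
    then show "v \<in> chained (f ` P) `` {f b}"
      by (simp only: Image_singleton_iff chained_image[OF assms])
  qed
  have q: "f ` P // chained (f ` P) = (`) f ` (P // chained P)"
  proof -
    have "f ` P // chained (f ` P) = (\<lambda>b. chained (f ` P) `` {f b}) ` P"
      by (auto simp: quotient_def)
    also have "\<dots> = (\<lambda>b. f ` (chained P `` {b})) ` P"
      using cl by (intro image_cong refl) auto
    also have "\<dots> = (`) f ` (P // chained P)"
      by (auto simp: quotient_def)
    finally show ?thesis .
  qed
  have sub: "C \<subseteq> P" if "C \<in> P // chained P" for C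
    using that by (auto simp: quotient_def chained_def)
  have "inj_on ((`) f) (P // chained P)"
    using sub by (intro inj_on_subset[OF inj_on_image_Pow[OF assms(1)]]) auto
  moreover have "card (f ` C) = card C" if "C \<in> P // chained P" for C
    using sub[OF that] assms(1) by (intro card_image) (rule inj_on_subset)
  ultimately show ?thesis
    using assms(1) by (simp add: weight_def q prod.reindex card_image)
qed

section \<open>Maximal intervals of a set\<close>

lemma runs_extends:
  assumes "finite U" "{a..b} \<subseteq> U" "a \<le> b"
  shows "\<exists>I\<in>runs U. {a..b} \<subseteq> I"
proof -
  define X where "X = {I. (\<exists>c d. c \<le> d \<and> I = {c..d}) \<and> {a..b} \<subseteq> I \<and> I \<subseteq> U}"
  have "finite X" unfolding X_def by (rule finite_subset[of _ "Pow U"]) (use assms(1) in auto)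
  moreover have "{a..b} \<in> X" unfolding X_def using assms by blast
  ultimately obtain I where I: "I \<in> X" "\<And>I'. I' \<in> X \<Longrightarrow> I \<subseteq> I' \<Longrightarrow> I = I'"
    using finite_has_maximal[of X] by (metis empty_iff)
  have "{c..d} = I" if "I \<subseteq> {c..d}" "{c..d} \<subseteq> U" for c d
  proof -
    have "{a..b} \<subseteq> {c..d}" using that I(1) by (auto simp: X_def)
    moreover from this have "c \<le> d" using assms(3) by auto
    ultimately have "{c..d} \<in> X" using that(2) unfolding X_def by blast
    then show ?thesis using I(2) that by metis
  qed
  moreover have "(\<exists>c d. c \<le> d \<and> I = {c..d})" "I \<subseteq> U" "{a..b} \<subseteq> I"
    using I(1) unfolding X_def by blast+
  ultimately show ?thesis unfolding runs_def by blast
qed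

text \<open>Two intervals that meet or touch have an interval as their union, so maximality makes them equal.\<close>

lemma runs_separated:
  assumes "I \<in> runs U" "I' \<in> runs U" "x \<in> I" "y \<in> I'" "x \<le> y + 1" "y \<le> x + 1"
  shows "I = I'"
proof -
  obtain a b where I: "I = {a..b}" using assms(1) by (auto simp: runs_def)
  obtain c d where I': "I' = {c..d}" using assms(2) by (auto simp: runs_def)
  have "{a..b} \<subseteq> U" "{c..d} \<subseteq> U" using assms(1,2) I I' by (auto simp: runs_def)
  moreover have "{min a c..max b d} \<subseteq> {a..b} \<union> {c..d}" using assms(3-6) I I' by auto
  ultimately have "{min a c..max b d} \<subseteq> U" by blast
  moreover have "I \<subseteq> {min a c..max b d}" "I' \<subseteq> {min a c..max b d}" using I I' by auto
  ultimately have "{min a c..max b d} = I" "{min a c..max b d} = I'"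
    using assms(1,2) unfolding runs_def by blast+
  then show ?thesis by simp
qed

lemma runs_atLeastAtMost:
  assumes "a \<le> (b::nat)"
  shows "runs {a..b} = {{a..b}}"
  using assms unfolding runs_def by auto

lemma finite_runs: "finite U \<Longrightarrow> finite (runs U)"
  by (rule finite_subset[of _ "Pow U"]) (auto simp: runs_def)

section \<open>Renumbering and noncrossing partitions\<close>

definition rank :: "nat set \<Rightarrow> nat \<Rightarrow> nat" where
  "rank U x = card {y \<in> U. y \<le> x}"

lemma renumber_rank: "renumber Y = (\<lambda>b. rank (\<Union>Y) ` b) ` Y"
  by (simp add: renumber_def rank_def)

lemma strict_mono_on_rank:
  assumes "finite U"
  shows "strict_mono_on U (rank U)"
proof (rule strict_mono_onI)
  fix x y assume "x \<in> U" "y \<in> U" "x < y"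
  then have "{z \<in> U. z \<le> x} \<subseteq> {z \<in> U. z \<le> y}" "y \<in> {z \<in> U. z \<le> y}" "y \<notin> {z \<in> U. z \<le> x}"
    by auto
  then have "{z \<in> U. z \<le> x} \<subset> {z \<in> U. z \<le> y}" by blast
  then show "rank U x < rank U y"
    unfolding rank_def using assms by (intro psubset_card_mono) auto
qed

lemma rank_image: 
  assumes "finite U"
  shows "rank U ` U = {1..card U}"
proof (rule card_subset_eq)
  show "rank U ` U \<subseteq> {1..card U}"
  proof
    fix r assume "r \<in> rank U ` U"
    then obtain x where "x \<in> U" "r = rank U x" by auto
    moreover have "rank U x \<le> card U" unfolding rank_def using assms by (intro card_mono) auto
    moreover have "card {x} \<le> rank U x" unfolding rank_def using assms \<open>x \<in> U\<close> by (intro card_mono) auto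
    ultimately show "r \<in> {1..card U}" by auto
  qed
  show "card (rank U ` U) = card {1..card U}"
    using strict_mono_on_imp_inj_on[OF strict_mono_on_rank[OF assms]] by (simp add: card_image)
qed simp

lemma rank_atLeastAtMost:
  assumes "x \<in> {a..b}"
  shows "rank {a..b} x = x + 1 - a"
proof -
  have "{y \<in> {a..b}. y \<le> x} = {a..x}" using assms by auto
  then show ?thesis by (simp add: rank_def)
qed

lemma partition_on_renumber:
  assumes "partition_on U Y" "finite U"
  shows "partition_on {1..card U} (renumber Y)"
proof -
  have U: "\<Union>Y = U" "{} \<notin> Y" using assms(1) by (auto simp: partition_on_def)
  have "partition_on (rank U ` U) ((`) (rank U) ` Y - {{}})"
    using strict_mono_on_imp_inj_on[OF strict_mono_on_rank[OF assms(2)]]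
    by (rule partition_on_inj_image[OF assms(1)])
  moreover have "(`) (rank U) ` Y - {{}} = renumber Y"
    using U by (auto simp: renumber_rank)
  ultimately show ?thesis by (simp add: rank_image assms(2))
qed

lemma noncrossingD:
  assumes "noncrossing P" "b \<in> P" "c \<in> P" "x \<in> b" "z \<in> b" "y \<in> c" "t \<in> c" "x < y" "y < z" "z < t"
  shows "b = c"
proof (rule ccontr)
  assume "b \<noteq> c"
  have "\<exists>x\<in>b. \<exists>z\<in>b. \<exists>y\<in>c. \<exists>t\<in>c. x < y \<and> y < z \<and> z < t"
    using assms(8-10) by (intro bexI[OF _ assms(4)] bexI[OF _ assms(5)] bexI[OF _ assms(6)] bexI[OF _ assms(7)]) simp
  then have "\<not> noncrossing P"
    unfolding noncrossing_def not_not using \<open>b \<noteq> c\<close>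
    by (intro bexI[OF _ assms(2)] bexI[OF _ assms(3)]) (rule conjI)
  then show False using assms(1) by simp
qed
lemma noncrossingI:
  assumes "\<And>b c x y z t. b \<in> P \<Longrightarrow> c \<in> P \<Longrightarrow> x \<in> b \<Longrightarrow> z \<in> b \<Longrightarrow> y \<in> c \<Longrightarrow> t \<in> c \<Longrightarrow>
    x < y \<Longrightarrow> y < z \<Longrightarrow> z < t \<Longrightarrow> b = c"
  shows "noncrossing P"
  unfolding noncrossing_def
proof (clarify)
  fix b c x z y t
  assume "b \<in> P" "c \<in> P" "b \<noteq> c" "x \<in> b" "z \<in> b" "y \<in> c" "t \<in> c" "x < y" "y < z" "z < t"
  with assms[of b c x z y t] show False by simp
qed

lemma noncrossing_subset: 
  assumes "noncrossing P" "Y \<subseteq> P" shows "noncrossing Y"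
proof (rule noncrossingI)
  fix b c x y z t
  assume "b \<in> Y" "c \<in> Y" and a: "x \<in> b" "z \<in> b" "y \<in> c" "t \<in> c" "x < y" "y < z" "z < t"
  then have "b \<in> P" "c \<in> P" using assms(2) by auto
  from noncrossingD[OF assms(1) this a] show "b = c" .
qed

lemma noncrossing_strict_mono_image:
  assumes "noncrossing Y" "strict_mono_on (\<Union>Y) r"
  shows "noncrossing ((\<lambda>b. r ` b) ` Y)"
proof (rule noncrossingI)
  fix rb rc x y z t
  assume "rb \<in> (\<lambda>b. r ` b) ` Y" "rc \<in> (\<lambda>b. r ` b) ` Y"
    and m: "x \<in> rb" "z \<in> rb" "y \<in> rc" "t \<in> rc" and l: "x < y" "y < z" "z < t"
  then obtain b c where b: "b \<in> Y" "c \<in> Y" "rb = r ` b" "rc = r ` c" by auto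
  obtain x' y' z' t' where e: "x = r x'" "y = r y'" "z = r z'" "t = r t'"
    and m': "x' \<in> b" "z' \<in> b" "y' \<in> c" "t' \<in> c"
    using m unfolding b by auto
  have "x' \<in> \<Union>Y" "y' \<in> \<Union>Y" "z' \<in> \<Union>Y" "t' \<in> \<Union>Y" using m' b by auto
  then have "x' < y'" "y' < z'" "z' < t'"
    using l strict_mono_on_less[OF assms(2)] unfolding e by auto
  from noncrossingD[OF assms(1) b(1,2) m' this] show "rb = rc" by (simp add: b)
qed

lemma card_renumber:
  assumes "finite (\<Union>Y)"
  shows "card (renumber Y) = card Y"
  unfolding renumber_rank
  using strict_mono_on_imp_inj_on[OF strict_mono_on_rank[OF assms]]
  by (intro card_image, rule inj_on_subset[OF inj_on_image_Pow]) auto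

lemma ncp_Union: "noncrossing_partition n P \<Longrightarrow> \<Union>P = {1..n}"
  by (simp add: noncrossing_partition_def partition_on_def)

lemma ncp_block_nonempty: "noncrossing_partition n P \<Longrightarrow> b \<in> P \<Longrightarrow> b \<noteq> {}"
  by (auto simp: noncrossing_partition_def partition_on_def)

lemma finite_ncp_block: "noncrossing_partition n P \<Longrightarrow> b \<in> P \<Longrightarrow> finite b"
  by (rule finite_subset[of b "{1..n}"]) (use ncp_Union in blast, simp)

lemma finite_ncp:
  assumes "noncrossing_partition n P" shows "finite P"
proof (rule finite_elements)
  show "partition_on {1..n} P" using assms by (simp add: noncrossing_partition_def)
qed simp

lemma Min_in_ncp_block: "noncrossing_partition n P \<Longrightarrow> b \<in> P \<Longrightarrow> Min b \<in> b"
  by (simp add: finite_ncp_block ncp_block_nonempty)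

lemma Max_in_ncp_block: "noncrossing_partition n P \<Longrightarrow> b \<in> P \<Longrightarrow> Max b \<in> b"
  by (simp add: finite_ncp_block ncp_block_nonempty)

lemma ncp_block_unique:
  assumes "noncrossing_partition n P" "b \<in> P" "c \<in> P" "x \<in> b" "x \<in> c"
  shows "b = c"
  using assms disjointD[of P b c] by (auto simp: noncrossing_partition_def partition_on_def)

lemma noncrossing_partition_renumber:
  assumes "noncrossing_partition n P" "Y \<subseteq> P" "Y \<noteq> {}"
  shows "noncrossing_partition (card (\<Union>Y)) (renumber Y)"
proof -
  have P: "partition_on {1..n} P" "noncrossing P"
    using assms(1) by (auto simp: noncrossing_partition_def)
  have "disjoint Y" using P(1) assms(2) pairwise_subset by (auto simp: partition_on_def)
  hence Y: "partition_on (\<Union>Y) Y"  "noncrossing Y"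
    using P assms(2) noncrossing_subset by (auto simp: partition_on_def)
  have "\<Union>Y \<subseteq> {1..n}" using P(1) assms(2) by (auto simp: partition_on_def)
  hence fin: "finite (\<Union>Y)" by (rule finite_subset) simp
  have "\<Union>Y \<noteq> {}" using Y(1) assms(3) by (auto simp: partition_on_def)
  hence "1 \<le> card (\<Union>Y)" using fin by (simp add: Suc_le_eq card_gt_0_iff)
  then show ?thesis
    using partition_on_renumber[OF Y(1) fin]
      noncrossing_strict_mono_image[OF Y(2) strict_mono_on_rank[OF fin]]
    by (simp add: noncrossing_partition_def renumber_rank)
qed

lemma ncp_noncrossing_partition: "\<exists>n. noncrossing_partition n (blocks \<pi>)"
  using blocks by blast

lemma blocks_renumber:
  assumes "Y \<subseteq> blocks \<pi>" "Y \<noteq> {}"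
  shows "blocks (Abs_ncp (renumber Y)) = renumber Y"
  using ncp_noncrossing_partition[of \<pi>] noncrossing_partition_renumber assms
  by (subst Abs_ncp_inverse) blast+

lemma renumber_interval:
  assumes "\<Union>Y = {a..b}"
  shows "renumber Y = (\<lambda>c. (\<lambda>x. x + 1 - a) ` c) ` Y"
  unfolding renumber_rank assms
  by (intro image_cong refl rank_atLeastAtMost) (use assms in blast)

text \<open>On an interval, renumbering is a translation, which preserves adjacency. For a set of blocks
whose union has gaps this may fail: closing a gap can create new adjacencies.\<close>

lemma weight_renumber_interval:
  assumes "\<Union>Y = {a..b}" "{} \<notin> Y"
  shows "weight (renumber Y) = weight Y"
  unfolding renumber_interval[OF assms(1)]
proof (rule weight_image)
  let ?s = "\<lambda>x. x + 1 - a"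
  have "inj_on ?s {a..b}" by (auto simp: inj_on_def)
  then show "inj_on ((`) ?s) Y"
    by (rule inj_on_subset[OF inj_on_image_Pow]) (use assms in auto)
  fix c d assume cd: "c \<in> Y" "d \<in> Y"
  have mono: "mono ?s" by (auto simp: mono_def)
  have sub: "c \<subseteq> {a..b}" "d \<subseteq> {a..b}" using cd assms(1) by blast+
  hence fin: "finite c" "finite d" using finite_subset by blast+
  have ne: "c \<noteq> {}" "d \<noteq> {}" using cd assms(2) by auto
  have "Max (?s ` c) = ?s (Max c)" "Min (?s ` d) = ?s (Min d)"
    using mono_Max_commute[OF mono fin(1) ne(1)] mono_Min_commute[OF mono fin(2) ne(2)] by simp_all
  moreover have "a \<le> Max c" "a \<le> Min d" using sub fin ne Max_in Min_in by (metis atLeastAtMost_iff subsetD)+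
  ultimately show "Max (?s ` c) + 1 = Min (?s ` d) \<longleftrightarrow> Max c + 1 = Min d" by auto
qed

section \<open>The chain relation as an equivalence closure\<close>

text \<open>As every step is determined by either of its end points, along a path in
\<open>A \<union> A\<inverse>\<close> a change of direction undoes the step before it.\<close>

lemma rtrancl_Un_converse:
  assumes "single_valued A" "single_valued (A\<inverse>)"
  shows "(A \<union> A\<inverse>)\<^sup>* = A\<^sup>* \<union> (A\<inverse>)\<^sup>*"
proof
  have extend: "(x, z) \<in> A\<^sup>* \<union> (A\<inverse>)\<^sup>*"
    if "single_valued (A\<inverse>)" "(x, y) \<in> A\<^sup>*" "(y, z) \<in> A \<union> A\<inverse>" for x y z and A :: "('b \<times> 'b) set"
  proof (cases "(y, z) \<in> A")
    case True
    then show ?thesis using that(2) by (auto intro: rtrancl_into_rtrancl)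
  next
    case False
    hence zy: "(z, y) \<in> A" using that(3) by auto
    from that(2) show ?thesis
    proof (cases rule: rtranclE)
      case base
      then show ?thesis using zy by auto
    next
      case (step w)
      hence "w = z" using that(1) zy by (auto simp: single_valued_def)
      then show ?thesis using step by auto
    qed
  qed
  show "(A \<union> A\<inverse>)\<^sup>* \<subseteq> A\<^sup>* \<union> (A\<inverse>)\<^sup>*"
  proof (rule subrelI)
    fix x y assume "(x, y) \<in> (A \<union> A\<inverse>)\<^sup>*"
    then show "(x, y) \<in> A\<^sup>* \<union> (A\<inverse>)\<^sup>*"
    proof induction
      case (step y z)
      then show ?case using extend[of A x y z] extend[of "A\<inverse>" x y z] assms by (auto simp: Un_commute)
    qed simp
  qed
  show "A\<^sup>* \<union> (A\<inverse>)\<^sup>* \<subseteq> (A \<union> A\<inverse>)\<^sup>*"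
    by (simp add: rtrancl_mono)
qed

lemma rtrancl_iff_list:
  "(x, y) \<in> R\<^sup>* \<longleftrightarrow>
     (\<exists>xs. xs \<noteq> [] \<and> hd xs = x \<and> last xs = y \<and> (\<forall>i. Suc i < length xs \<longrightarrow> (xs ! i, xs ! Suc i) \<in> R))"
proof
  assume "(x, y) \<in> R\<^sup>*"
  then obtain n f where f: "f 0 = x" "f n = y" "\<And>i. i < n \<Longrightarrow> (f i, f (Suc i)) \<in> R"
    unfolding rtrancl_is_UN_relpow UN_iff relpow_fun_conv by blast
  show "\<exists>xs. xs \<noteq> [] \<and> hd xs = x \<and> last xs = y \<and> (\<forall>i. Suc i < length xs \<longrightarrow> (xs ! i, xs ! Suc i) \<in> R)"
    using f by (intro exI[of _ "map f [0..<Suc n]"]) (auto simp: hd_map last_map nth_append simp del: upt_Suc)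
next
  assume "\<exists>xs. xs \<noteq> [] \<and> hd xs = x \<and> last xs = y \<and> (\<forall>i. Suc i < length xs \<longrightarrow> (xs ! i, xs ! Suc i) \<in> R)"
  then obtain xs where xs: "xs \<noteq> []" "hd xs = x" "last xs = y"
    "\<And>i. Suc i < length xs \<Longrightarrow> (xs ! i, xs ! Suc i) \<in> R" by auto
  have "(x, y) \<in> R ^^ (length xs - 1)"
    unfolding relpow_fun_conv using xs
    by (intro exI[of _ "\<lambda>i. xs ! i"]) (auto simp: hd_conv_nth last_conv_nth)
  then show "(x, y) \<in> R\<^sup>*" by (rule relpow_imp_rtrancl)
qed

text \<open>Since the blocks are disjoint, each has at most one right and at most one left neighbour. Hence a
path in the undirected adjacency graph can be made monotone, and monotone paths are the sequences
in the definition of the chain relation.\<close>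

lemma chain_rel_eq_chained: "chain_rel \<pi> = chained (blocks \<pi>)"
proof -
  let ?P = "blocks \<pi>"
  define A where "A = {(b, c). b \<in> ?P \<and> c \<in> ?P \<and> Max b + 1 = Min c}"
  obtain n where np: "noncrossing_partition n ?P" using ncp_noncrossing_partition by blast
  have "b = c" if "b \<in> ?P" "c \<in> ?P" "Min b = Min c \<or> Max b = Max c" for b c
    using that ncp_block_unique[OF np that(1,2)] Min_in_ncp_block[OF np] Max_in_ncp_block[OF np] by metis
  hence "single_valued A" "single_valued (A\<inverse>)"
    by (fastforce simp: single_valued_def A_def)+
  moreover have "link ?P = A \<union> A\<inverse>" by (auto simp: link_def A_def)
  ultimately have link: "(link ?P)\<^sup>* = A\<^sup>* \<union> (A\<inverse>)\<^sup>*" by (simp add: rtrancl_Un_converse)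
  have A: "(b, c) \<in> A\<^sup>* \<and> b \<in> ?P \<longleftrightarrow> (\<exists>bs. bs \<noteq> [] \<and> set bs \<subseteq> ?P \<and> hd bs = b \<and> last bs = c \<and>
      (\<forall>i. Suc i < length bs \<longrightarrow> Max (bs ! i) + 1 = Min (bs ! Suc i)))" for b c
  proof -
    have "(bs ! 0 \<in> ?P \<and> (\<forall>i. Suc i < length bs \<longrightarrow> (bs ! i, bs ! Suc i) \<in> A)) \<longleftrightarrow>
       (set bs \<subseteq> ?P \<and> (\<forall>i. Suc i < length bs \<longrightarrow> Max (bs ! i) + 1 = Min (bs ! Suc i)))" (is "?l \<longleftrightarrow> ?r")
      if "bs \<noteq> []" for bs
    proof
      assume l: ?l
      have "bs ! i \<in> ?P" if "i < length bs" for i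
        using l that by (cases i) (auto simp: A_def)
      then show ?r using l by (auto simp: A_def in_set_conv_nth)
    next
      assume ?r
      then show ?l using that by (auto simp: A_def subset_iff)
    qed
    then show ?thesis unfolding rtrancl_iff_list by (metis hd_conv_nth)
  qed
  have "b \<in> ?P \<longleftrightarrow> c \<in> ?P" if "(b, c) \<in> A\<^sup>*" for b c
    using that by induction (auto simp: A_def)
  hence "(b, c) \<in> chained ?P \<longleftrightarrow> ((b, c) \<in> A\<^sup>* \<and> b \<in> ?P) \<or> ((c, b) \<in> A\<^sup>* \<and> c \<in> ?P)" for b c
    by (auto simp: chained_def link rtrancl_converse)
  then show ?thesis
    unfolding A by (auto simp: chain_rel_def)
qed

section \<open>The outer chain and the recursion for the weight\<close>

lemma nest_le_iff:
  assumes "noncrossing_partition n P" "b \<in> P" "c \<in> P"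
  shows "nest_le b c \<longleftrightarrow> Min b \<le> Min c \<and> Max c \<le> Max b"
proof -
  have "finite c" "c \<noteq> {}" using assms finite_ncp_block ncp_block_nonempty by blast+
  then show ?thesis
    unfolding nest_le_def using Min_in Max_in Min_le Max_ge
    by (meson atLeastAtMost_iff order_trans subset_iff)
qed

text \<open>The only other relative position of the two hulls is a proper overlap, in which the four endpoints
form a crossing.\<close>

lemma ncp_separated_or_nested:
  assumes "noncrossing_partition n P" "b \<in> P" "c \<in> P"
  shows "Max b < Min c \<or> Max c < Min b \<or> nest_le b c \<or> nest_le c b"
proof (cases "b = c")
  case True
  then show ?thesis using nest_le_iff[OF assms] by simp
next
  case False
  have nc: "noncrossing P" using assms(1) by (simp add: noncrossing_partition_def)
  note mem = Min_in_ncp_block[OF assms(1,2)] Max_in_ncp_block[OF assms(1,2)]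
    Min_in_ncp_block[OF assms(1,3)] Max_in_ncp_block[OF assms(1,3)]
  have ne: "x \<noteq> y" if "x \<in> b" "y \<in> c" for x y
    using ncp_block_unique[OF assms] that False by blast
  have "\<not> (Min b < Min c \<and> Min c < Max b \<and> Max b < Max c)"
    using noncrossingD[OF nc assms(2,3) mem] False by blast
  moreover have "\<not> (Min c < Min b \<and> Min b < Max c \<and> Max c < Max b)"
    using noncrossingD[OF nc assms(3,2) mem(3,4,1,2)] False by blast
  ultimately show ?thesis
    using nest_le_iff[OF assms(1,2,3)] nest_le_iff[OF assms(1,3,2)] mem
      ne[of "Min b" "Min c"] ne[of "Min b" "Max c"] ne[of "Max b" "Min c"] ne[of "Max b" "Max c"]
    by linarith
qed

text \<open>From the left block, step repeatedly to the right neighbour; since blocks are separated, the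
neighbour never jumps over the target.\<close>

lemma chained_if_gapless:
  assumes "\<And>b. b \<in> S \<Longrightarrow> Min b \<le> Max b"
    and sep: "\<And>b c. b \<in> S \<Longrightarrow> c \<in> S \<Longrightarrow> b \<noteq> c \<Longrightarrow> Max b < Min c \<or> Max c < Min b"
    and gap: "\<And>b c. b \<in> S \<Longrightarrow> c \<in> S \<Longrightarrow> Max b < Min c \<Longrightarrow> \<exists>d\<in>S. Max b + 1 = Min d"
    and "b \<in> S" "c \<in> S"
  shows "(b, c) \<in> chained S"
proof -
  have less: "(b, c) \<in> (link S)\<^sup>*" if "b \<in> S" "c \<in> S" "Max b < Min c" for b c
    using that
  proof (induction "Min c - Max b" arbitrary: b rule: less_induct)
    case less
    obtain d where d: "d \<in> S" "Max b + 1 = Min d" using gap[OF less.prems] by blast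
    have link: "(b, d) \<in> link S" using d less.prems by (auto simp: link_def)
    show ?case
    proof (cases "d = c")
      case False
      have "Max d < Min c"
        using sep[OF d(1) less.prems(2) False] assms(1)[OF less.prems(2)] less.prems(3) d(2) by linarith
      moreover have "Min c - Max d < Min c - Max b"
        using assms(1)[OF d(1)] d(2) \<open>Max d < Min c\<close> by linarith
      ultimately have "(d, c) \<in> (link S)\<^sup>*" using less.hyps d(1) less.prems(2) by blast
      then show ?thesis using link by (rule converse_rtrancl_into_rtrancl[rotated])
    qed (use link in auto)
  qed
  have "(b, c) \<in> (link S)\<^sup>*"
  proof (cases "b = c")
    case False
    then show ?thesis
      using sep[OF assms(4,5)] less[OF assms(4,5)] less[OF assms(5,4)]
        symD[OF sym_rtrancl[OF sym_link[of S]]] by blast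
  qed simp
  then show ?thesis using assms(4,5) by (simp add: chained_def)
qed

text \<open>These are the minimal elements of the nesting order. They form the chain of blocks met when
\<open>{1..n}\<close> is crossed from left to right at the outermost level.\<close>

definition outer :: "nat set set \<Rightarrow> nat set set" where
  "outer P = {b \<in> P. \<forall>c\<in>P. nest_le c b \<longrightarrow> c = b}"

context
  fixes n :: nat and P :: "nat set set"
  assumes ncp: "noncrossing_partition n P"
begin

lemma ncp_Min_le_Max: "b \<in> P \<Longrightarrow> Min b \<le> Max b"
  using Min_in_ncp_block[OF ncp] finite_ncp_block[OF ncp] by (simp add: Max_ge)

lemma ncp_endpoints_differ:
  assumes "b \<in> P" "c \<in> P" "b \<noteq> c"
  shows "Min b \<noteq> Min c" "Max b \<noteq> Max c" "Min b \<noteq> Max c"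
  using ncp_block_unique[OF ncp assms(1,2)] assms(3) Min_in_ncp_block[OF ncp] Max_in_ncp_block[OF ncp] assms(1,2)
  by metis+

lemma outer_subset: "outer P \<subseteq> P"
  by (auto simp: outer_def)

lemma outer_not_nested: "b \<in> outer P \<Longrightarrow> c \<in> P \<Longrightarrow> nest_le c b \<Longrightarrow> c = b"
  by (auto simp: outer_def)

lemma outer_separated:
  assumes "b \<in> outer P" "c \<in> outer P" "b \<noteq> c"
  shows "Max b < Min c \<or> Max c < Min b"
  using ncp_separated_or_nested[OF ncp, of b c] assms outer_subset outer_not_nested by blast

text \<open>A block that strictly encloses a neighbour of \<open>b\<close> would overlap \<open>b\<close> or enclose it.\<close>

lemma outer_neighbour:
  assumes b: "b \<in> outer P" and d: "d \<in> P" "Max b + 1 = Min d \<or> Max d + 1 = Min b"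
  shows "d \<in> outer P"
  unfolding outer_def
proof (intro CollectI conjI ballI impI, fact)
  fix e assume e: "e \<in> P" "nest_le e d"
  have bP: "b \<in> P" using b outer_subset by auto
  show "e = d"
  proof (rule ccontr)
    assume "e \<noteq> d"
    note ed = ncp_endpoints_differ[OF e(1) d(1) this]
    have n: "Min e \<le> Min d" "Max d \<le> Max e" using nest_le_iff[OF ncp e(1) d(1)] e(2) by auto
    then have "e \<noteq> b" using d(2) ncp_Min_le_Max[OF d(1)] by auto
    then have "\<not> nest_le e b" using outer_not_nested[OF b e(1)] by auto
    with ncp_separated_or_nested[OF ncp bP e(1)] nest_le_iff[OF ncp bP e(1)]
    show False using n ed d(2) ncp_Min_le_Max[OF d(1)] ncp_Min_le_Max[OF bP] by arith
  qed
qed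

lemma unlinked_outer_rest: "unlinked (outer P) (P - outer P)"
  unfolding unlinked_def using outer_neighbour by blast

text \<open>The block containing the point after \<open>b\<close> reaches beyond \<open>b\<close> and cannot enclose it, so it is
separated from \<open>b\<close> and starts at that point.\<close>

lemma outer_next:
  assumes b: "b \<in> outer P" and "Max b < n"
  shows "\<exists>d\<in>outer P. Max b + 1 = Min d"
proof -
  have bP: "b \<in> P" using b outer_subset by auto
  have "Max b + 1 \<in> \<Union>P" using assms(2) by (simp add: ncp_Union[OF ncp])
  then obtain d where d: "d \<in> P" "Max b + 1 \<in> d" by blast
  have "Min d \<le> Max b + 1" "Max b + 1 \<le> Max d" using d finite_ncp_block[OF ncp] by simp_all
  moreover from this have "d \<noteq> b" by auto
  then have "\<not> nest_le d b" using outer_not_nested[OF b d(1)] by auto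
  ultimately have "Max b + 1 = Min d"
    using ncp_separated_or_nested[OF ncp bP d(1)] nest_le_iff[OF ncp bP d(1)] ncp_Min_le_Max[OF bP]
    by linarith
  then show ?thesis using outer_neighbour[OF b d(1)] by blast
qed

lemma outer_nonempty: "outer P \<noteq> {}"
proof -
  have n: "1 \<le> n" using ncp by (simp add: noncrossing_partition_def)
  then have "1 \<in> \<Union>P" by (simp add: ncp_Union[OF ncp])
  then obtain b where b: "b \<in> P" "1 \<in> b" by blast
  have "b \<in> outer P"
    unfolding outer_def
  proof (intro CollectI conjI ballI impI, fact)
    fix c assume c: "c \<in> P" "nest_le c b"
    have "Min c \<in> {1..n}" using Min_in_ncp_block[OF ncp c(1)] c(1) ncp_Union[OF ncp] by blast
    moreover have "Min c \<le> 1"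
      using c(2) nest_le_iff[OF ncp c(1) b(1)] Min_le[OF finite_ncp_block[OF ncp b(1)] b(2)] by simp
    ultimately have "Min c = 1" by simp
    then show "c = b"
      using ncp_block_unique[OF ncp c(1) b(1)] Min_in_ncp_block[OF ncp c(1)] b(2) by metis
  qed
  then show ?thesis by auto
qed

lemma finite_outer: "finite (outer P)"
  using finite_ncp[OF ncp] outer_subset by (rule finite_subset[rotated])

text \<open>A segment of the outer chain is a single chain. The cases needed are the whole outer chain and
its parts to the left and right of one block; the last two may be empty, and then \<open>catalan 0 = 1\<close>
is the right factor.\<close>

lemma weight_outer_segment:
  assumes "S \<subseteq> outer P"
    and convex: "\<And>b c d. b \<in> S \<Longrightarrow> c \<in> S \<Longrightarrow> d \<in> outer P \<Longrightarrow> Max b < Min d \<Longrightarrow> Min d \<le> Min c \<Longrightarrow> d \<in> S"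
  shows "weight S = (- 1) ^ card S * catalan (card S)"
proof (rule weight_total)
  show "finite S" using assms(1) finite_outer finite_subset by blast
  have SP: "S \<subseteq> P" using assms(1) outer_subset by blast
  show "(b, c) \<in> chained S" if "b \<in> S" "c \<in> S" for b c
  proof (rule chained_if_gapless[OF _ _ _ that])
    fix b c assume bc: "b \<in> S" "c \<in> S" "Max b < Min c"
    have "Min c \<in> {1..n}" using Min_in_ncp_block[OF ncp, of c] bc(2) SP ncp_Union[OF ncp] by blast
    then have "Max b < n" using bc(3) by simp
    then obtain d where "d \<in> outer P" "Max b + 1 = Min d" using outer_next bc(1) assms(1) by blast
    then show "\<exists>d\<in>S. Max b + 1 = Min d" using convex[OF bc(1,2), of d] bc(3) by auto
  qed (use SP ncp_Min_le_Max outer_separated assms(1) in blast)+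
qed

lemma weight_outer_rest:
  "(weight P :: 'k::field_char_0) = (- 1) ^ card (outer P) * catalan (card (outer P)) * weight (P - outer P)"
proof -
  have "weight (outer P \<union> (P - outer P)) = weight (outer P) * (weight (P - outer P) :: 'k)"
    using unlinked_outer_rest finite_outer finite_ncp[OF ncp] by (intro weight_Un) auto
  also have "outer P \<union> (P - outer P) = P" using outer_subset by auto
  also have "(weight (outer P) :: 'k) = (- 1) ^ card (outer P) * catalan (card (outer P))"
    by (rule weight_outer_segment) auto
  finally show ?thesis .
qed

text \<open>No outer block is adjacent to an inner one, so removing an outer block cuts the outer chain in two
and leaves every other chain as it is.\<close>

lemma weight_remove_outer:
  assumes b: "b \<in> outer P"
  defines "L \<equiv> {c \<in> outer P. Max c < Min b}" and "R \<equiv> {c \<in> outer P. Max b < Min c}"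
  shows "(weight (P - {b}) :: 'k::field_char_0) =
    (- 1) ^ (card (outer P) - 1) * (catalan (card L) * catalan (card R)) * weight (P - outer P)"
proof -
  have bP: "b \<in> P" using b outer_subset by auto
  have sub: "L \<subseteq> outer P" "R \<subseteq> outer P" by (auto simp: L_def R_def)
  have fin: "finite L" "finite R" using sub finite_outer finite_subset by blast+
  have LR: "unlinked L R" "L \<inter> R = {}"
  proof -
    have "Max c + 1 < Min d \<and> Max d + 1 \<noteq> Min c \<and> c \<noteq> d" if "c \<in> L" "d \<in> R" for c d
    proof -
      have "c \<in> P" "d \<in> P" using that sub outer_subset by auto
      then show ?thesis
        using that ncp_Min_le_Max[of c] ncp_Min_le_Max[of d] ncp_Min_le_Max[OF bP] by (auto simp: L_def R_def)
    qed
    then show "unlinked L R" "L \<inter> R = {}" unfolding unlinked_def by (metis less_irrefl, blast)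
  qed
  have outer: "outer P - {b} = L \<union> R"
  proof
    show "outer P - {b} \<subseteq> L \<union> R" using outer_separated[OF b] by (auto simp: L_def R_def)
    have "b \<notin> L" "b \<notin> R" using ncp_Min_le_Max[OF bP] by (auto simp: L_def R_def)
    then show "L \<union> R \<subseteq> outer P - {b}" using sub by auto
  qed
  have "card (outer P) - 1 = card L + card R"
    using card_Un_disjoint[OF fin LR(2)] outer b finite_outer by (metis card_Diff_singleton)
  moreover have "P - {b} = (L \<union> R) \<union> (P - outer P)"
    using outer outer_subset b by auto
  moreover have "weight ((L \<union> R) \<union> (P - outer P)) = weight L * weight R * (weight (P - outer P) :: 'k)"
  proof -
    have "unlinked (L \<union> R) (P - outer P)"
      using unlinked_outer_rest sub unfolding unlinked_def by blast
    then have "weight ((L \<union> R) \<union> (P - outer P)) = weight (L \<union> R) * (weight (P - outer P) :: 'k)"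
      using sub fin finite_ncp[OF ncp] by (intro weight_Un) auto
    also have "(weight (L \<union> R) :: 'k) = weight L * weight R" by (rule weight_Un[OF LR fin])
    finally show ?thesis .
  qed
  moreover have "(weight L :: 'k) = (- 1) ^ card L * catalan (card L)"
  proof (rule weight_outer_segment[OF sub(1)])
    fix c d e assume h: "c \<in> L" "d \<in> L" "e \<in> outer P" "Max c < Min e" "Min e \<le> Min d"
    then have "d \<in> P" using sub outer_subset by auto
    then show "e \<in> L"
      using h outer_separated[OF b h(3)] ncp_Min_le_Max[of d] ncp_Min_le_Max[OF bP]
      by (cases "e = b") (auto simp: L_def)
  qed
  moreover have "(weight R :: 'k) = (- 1) ^ card R * catalan (card R)"
  proof (rule weight_outer_segment[OF sub(2)])
    fix c d e assume h: "c \<in> R" "d \<in> R" "e \<in> outer P" "Max c < Min e" "Min e \<le> Min d"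
    then have "c \<in> P" using sub outer_subset by auto
    then show "e \<in> R" using h ncp_Min_le_Max[of c] by (auto simp: R_def)
  qed
  ultimately show ?thesis by (simp add: power_add ac_simps)
qed

text \<open>By the two preceding lemmas the sum over the outer blocks is, up to sign and the common factor of
the inner chains, the Catalan convolution.\<close>

lemma weight_recursion: "weight P + (\<Sum>b\<in>outer P. weight (P - {b})) = (0 :: 'k::field_char_0)"
proof -
  let ?M = "outer P"
  let ?c = "catalan :: nat \<Rightarrow> 'k"
  obtain m where m: "card ?M = Suc m"
    using outer_nonempty finite_outer by (metis card_eq_0_iff not0_implies_Suc)
  have inj: "inj_on Min ?M"
    using ncp_endpoints_differ(1) outer_subset by (meson inj_onI subsetD)
  have iff: "Min c < Min b \<longleftrightarrow> Max c < Min b" if "b \<in> ?M" "c \<in> ?M" for b c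
    using outer_separated[OF that] ncp_Min_le_Max that outer_subset by (cases "b = c") fastforce+
  have L: "card {y \<in> Min ` ?M. y < Min b} = card {c \<in> ?M. Max c < Min b}" if "b \<in> ?M" for b
  proof -
    have "{y \<in> Min ` ?M. y < Min b} = Min ` {c \<in> ?M. Max c < Min b}" using iff that by auto
    then show ?thesis using inj by (simp add: card_image inj_on_def)
  qed
  have R: "card {y \<in> Min ` ?M. Min b < y} = card {c \<in> ?M. Max b < Min c}" if "b \<in> ?M" for b
  proof -
    have "{y \<in> Min ` ?M. Min b < y} = Min ` {c \<in> ?M. Max b < Min c}" using iff that by auto
    then show ?thesis using inj by (simp add: card_image inj_on_def)
  qed
  have "(\<Sum>b\<in>?M. ?c (card {c \<in> ?M. Max c < Min b}) * ?c (card {c \<in> ?M. Max b < Min c})) =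
      (\<Sum>x\<in>Min ` ?M. ?c (card {y \<in> Min ` ?M. y < x}) * ?c (card {y \<in> Min ` ?M. x < y}))"
    using inj by (simp add: sum.reindex L R)
  also have "\<dots> = (\<Sum>i<Suc m. ?c i * ?c (m - i))"
    using sum_rank_eq[of "Min ` ?M" "\<lambda>i j. ?c i * ?c j"] finite_outer inj by (simp add: card_image m)
  also have "\<dots> = ?c (Suc m)"
    by (simp add: lessThan_Suc_atMost catalan_convolution)
  finally have "(\<Sum>b\<in>?M. weight (P - {b})) = (- 1) ^ m * ?c (Suc m) * weight (P - ?M)"
    by (simp add: weight_remove_outer m flip: sum_distrib_left sum_distrib_right)
  then show ?thesis by (simp add: weight_outer_rest m)
qed

section \<open>Removing an outer block and splitting into maximal intervals\<close>

text \<open>If a point of the outer block \<open>b\<close> lay inside the hull of \<open>c\<close>, then, as \<open>c\<close> does not enclose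
\<open>b\<close>, some end point of \<open>b\<close> would lie outside that hull, which is a crossing.\<close>

lemma hull_avoids_outer:
  assumes b: "b \<in> outer P" and c: "c \<in> P" "c \<noteq> b"
  shows "{Min c..Max c} \<subseteq> \<Union>(P - {b})"
proof
  fix x assume x: "x \<in> {Min c..Max c}"
  have bP: "b \<in> P" using b outer_subset by auto
  have mem: "Min c \<in> c" "Max c \<in> c" "Min b \<in> b" "Max b \<in> b"
    using Min_in_ncp_block[OF ncp] Max_in_ncp_block[OF ncp] bP c(1) by auto
  have nc: "noncrossing P" using ncp by (simp add: noncrossing_partition_def)
  have "{Min c, Max c} \<subseteq> {1..n}" using mem c(1) ncp_Union[OF ncp] by blast
  then have "x \<in> \<Union>P" using x by (auto simp: ncp_Union[OF ncp])
  moreover have "x \<notin> b"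
  proof
    assume xb: "x \<in> b"
    have "x \<noteq> Min c" "x \<noteq> Max c"
      using ncp_block_unique[OF ncp bP c(1) xb] mem c(2) by metis+
    then have lt: "Min c < x" "x < Max c" using x by auto
    have "\<not> nest_le c b" using outer_not_nested[OF b c(1)] c(2) by auto
    then consider "Min b < Min c" | "Max c < Max b"
      using nest_le_iff[OF ncp c(1) bP] by linarith
    then show False
    proof cases
      case 1
      then show False using noncrossingD[OF nc bP c(1) mem(3) xb mem(1,2)] lt c(2) by auto
    next
      case 2
      then show False using noncrossingD[OF nc c(1) bP mem(1,2) xb mem(4)] lt c(2) by auto
    qed
  qed
  ultimately show "x \<in> \<Union>(P - {b})" by auto
qed

text \<open>Each remaining block lies in one maximal interval, and blocks in different maximal intervals are
never adjacent, so chains do not connect different intervals.\<close>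

lemma runs_remove_outer:
  assumes b: "b \<in> outer P"
  defines "J \<equiv> P - {b}"
  shows "\<And>I. I \<in> runs (\<Union>J) \<Longrightarrow> \<Union>{c \<in> J. c \<subseteq> I} = I"
    and "weight J = (\<Prod>I\<in>runs (\<Union>J). weight {c \<in> J. c \<subseteq> I})"
proof -
  have "\<Union>J \<subseteq> {1..n}" using ncp_Union[OF ncp] unfolding J_def by blast
  then have fin: "finite (\<Union>J)" by (rule finite_subset) simp
  have JP: "J \<subseteq> P" by (auto simp: J_def)
  have ends: "c \<subseteq> {Min c..Max c}" "Min c \<in> c" "Max c \<in> c" if "c \<in> J" for c
    using that JP finite_ncp_block[OF ncp] Min_in_ncp_block[OF ncp] Max_in_ncp_block[OF ncp] by auto
  have run: "\<exists>I\<in>runs (\<Union>J). c \<subseteq> I" if "c \<in> J" for c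
  proof -
    have "{Min c..Max c} \<subseteq> \<Union>J" using that hull_avoids_outer[OF b, of c] by (auto simp: J_def)
    moreover have "Min c \<le> Max c" using that JP ncp_Min_le_Max by auto
    ultimately have "\<exists>I\<in>runs (\<Union>J). {Min c..Max c} \<subseteq> I" by (rule runs_extends[OF fin])
    then show ?thesis using ends(1)[OF that] by blast
  qed
  show "\<Union>{c \<in> J. c \<subseteq> I} = I" if I: "I \<in> runs (\<Union>J)" for I
  proof
    show "I \<subseteq> \<Union>{c \<in> J. c \<subseteq> I}"
    proof
      fix x assume x: "x \<in> I"
      then have "x \<in> \<Union>J" using I by (auto simp: runs_def)
      then obtain c where c: "c \<in> J" "x \<in> c" by blast
      from run[OF c(1)] obtain I' where I': "I' \<in> runs (\<Union>J)" "c \<subseteq> I'" by blast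
      then have "I = I'" using runs_separated[OF I I'(1) x, of x] c(2) by auto
      then show "x \<in> \<Union>{c \<in> J. c \<subseteq> I}" using c I' by blast
    qed
  qed auto
  have "(\<Union>I\<in>runs (\<Union>J). {c \<in> J. c \<subseteq> I}) = J" using run by auto
  then have "weight J = weight (\<Union>I\<in>runs (\<Union>J). {c \<in> J. c \<subseteq> I})" by simp
  also have "\<dots> = (\<Prod>I\<in>runs (\<Union>J). weight {c \<in> J. c \<subseteq> I})"
  proof (rule weight_UN)
    show "finite (runs (\<Union>J))" using fin by (rule finite_runs)
    show "finite {c \<in> J. c \<subseteq> I}" for I
      using finite_ncp[OF ncp] JP by (auto intro: finite_subset)
    fix I I' assume I: "I \<in> runs (\<Union>J)" "I' \<in> runs (\<Union>J)" "I \<noteq> I'"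
    have far: "\<not> (x \<le> y + 1 \<and> y \<le> x + 1)" if "x \<in> I" "y \<in> I'" for x y
      using runs_separated[OF I(1,2) that] I(3) by blast
    have "Max c + 1 \<noteq> Min d \<and> Max d + 1 \<noteq> Min c \<and> c \<noteq> d"
      if "c \<in> J" "d \<in> J" "c \<subseteq> I" "d \<subseteq> I'" for c d
    proof -
      have "Min c \<in> I" "Max c \<in> I" "Min d \<in> I'" "Max d \<in> I'" using ends that by blast+
      then show ?thesis using far[of "Max c" "Min d"] far[of "Min c" "Max d"] far[of "Min c" "Min d"] by auto
    qed
    then show "unlinked {c \<in> J. c \<subseteq> I} {c \<in> J. c \<subseteq> I'} \<and> {c \<in> J. c \<subseteq> I} \<inter> {c \<in> J. c \<subseteq> I'} = {}"
      unfolding unlinked_def by blast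
  qed
  finally show "weight J = (\<Prod>I\<in>runs (\<Union>J). weight {c \<in> J. c \<subseteq> I})" .
qed

end

lemma renumber_ncp:
  assumes "noncrossing_partition n P"
  shows "renumber P = P"
proof -
  have U: "\<Union>P = {1..n}" by (rule ncp_Union[OF assms])
  have "(\<lambda>x. x + 1 - 1) ` c = c" for c :: "nat set" by simp
  then show ?thesis unfolding renumber_interval[OF U] by simp
qed

section \<open>Evaluating the coproduct\<close>

text \<open>Evaluation on \<open>K[X] \<otimes> K[X]\<close>: the outer variable \<open>X \<otimes> 1\<close> becomes \<open>x\<close>, the inner
variable \<open>1 \<otimes> X\<close> becomes \<open>y\<close>.\<close>

definition eval2 :: "'k::comm_ring_1 \<Rightarrow> 'k \<Rightarrow> 'k poly poly \<Rightarrow> 'k" where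
  "eval2 x y P = poly (poly P [:x:]) y"

lemma eval2_tensor_poly: "eval2 x y (tensor_poly P Q) = poly P x * poly Q y"
proof -
  have "poly (map_poly (\<lambda>c. [:c:]) P) [:x:] = [:poly P x:]"
    by (induction P) (auto simp: map_poly_pCons)
  thus ?thesis by (simp add: eval2_def tensor_poly_def)
qed

lemma eval2_Delta_poly: "eval2 x y (Delta_poly P) = poly P (x + y)"
proof -
  have "poly (map_poly (\<lambda>c. [:c:]) P) [:x, 1:] = pcompose P [:x, 1:]"
    by (induction P) (auto simp: map_poly_pCons pcompose_pCons)
  moreover have "poly (tensor_poly [:0, 1:] 1 + tensor_poly 1 [:0, 1:]) [:x:] = [:x, 1:]"
    by (simp add: tensor_poly_def map_poly_pCons)
  ultimately show ?thesis
    by (simp add: eval2_def Delta_poly_def poly_pcompose tensor_poly_def)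
qed

text \<open>The linear form with value \<open>F k\<close> on the basis element \<open>k\<close>.\<close>

definition linear_form :: "('a \<Rightarrow> 'k) \<Rightarrow> ('a \<Rightarrow>\<^sub>0 'k) \<Rightarrow> 'k::comm_ring_1" where
  "linear_form F t = (\<Sum>k\<in>Poly_Mapping.keys t. Poly_Mapping.lookup t k * F k)"

lemma linear_form_superset:
  "finite A \<Longrightarrow> Poly_Mapping.keys t \<subseteq> A \<Longrightarrow> linear_form F t = (\<Sum>k\<in>A. Poly_Mapping.lookup t k * F k)"
  unfolding linear_form_def by (rule sum.mono_neutral_left) (auto simp: in_keys_iff)

lemma linear_form_add: "linear_form F (s + t) = linear_form F s + linear_form F t"
  using Poly_Mapping.keys_add[of s t]
  by (simp add: linear_form_superset[of "Poly_Mapping.keys s \<union> Poly_Mapping.keys t"]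
      lookup_add distrib_right sum.distrib)

lemma linear_form_sum: "linear_form F (\<Sum>i\<in>A. t i) = (\<Sum>i\<in>A. linear_form F (t i))"
  by (induction A rule: infinite_finite_induct) (auto simp: linear_form_add, auto simp: linear_form_def)

lemma linear_form_single: "linear_form F (Poly_Mapping.single k 1) = F k"
  by (simp add: linear_form_def)

lemma alg_lift_gen: "\<iota> 1 = 1 \<Longrightarrow> alg_lift \<iota> g (gen \<pi>) = g \<pi>"
  by (simp add: alg_lift_def gen_def)

lemma eval2_tensor_map:
  "eval2 x y (tensor_map \<phi> t) =
     linear_form (\<lambda>(m, m'). poly (\<phi> (Poly_Mapping.single m 1)) x * poly (\<phi> (Poly_Mapping.single m' 1)) y) t"
proof -
  have s: "eval2 x y (sum f A) = (\<Sum>i\<in>A. eval2 x y (f i))" for f :: "'b \<Rightarrow> 'a poly poly" and A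
    by (simp add: eval2_def poly_sum)
  have m: "eval2 x y (smult [:c:] P) = c * eval2 x y P" for c P
    by (simp add: eval2_def)
  show ?thesis
    unfolding tensor_map_def linear_form_def s
    by (intro sum.cong refl) (auto simp: m eval2_tensor_poly)
qed

lemma coproduct_evaluated:
  assumes "double_bialgebra_morphism \<phi>"
  shows "poly (\<phi> (gen \<pi>)) (x + y) =
    (\<Sum>J | is_ideal \<pi> J. poly (\<phi> (Poly_Mapping.single (restrict_blocks (blocks \<pi> - J)) 1)) x *
       poly (\<phi> (Poly_Mapping.single (restrict_ideal J) 1)) y)"
proof -
  have "poly (\<phi> (gen \<pi>)) (x + y) = eval2 x y (tensor_map \<phi> (Delta_ncp (gen \<pi>)))"
    using assms by (simp add: double_bialgebra_morphism_def eval2_Delta_poly[symmetric])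
  then show ?thesis
    by (simp add: eval2_tensor_map Delta_ncp_def alg_lift_gen linear_form_sum pure2_def linear_form_single)
qed

context
  fixes \<phi> :: "'k::field_char_0 ncp_alg \<Rightarrow> 'k poly"
  assumes dbm: "double_bialgebra_morphism \<phi>"
begin

lemma morphism_one: "\<phi> (Poly_Mapping.single {#} 1) = 1"
proof -
  have "\<phi> (Poly_Mapping.single 0 1) = [:1:]"
    using dbm unfolding double_bialgebra_morphism_def alg_morphism_def by blast
  thus ?thesis by simp
qed

lemma morphism_monomial_sum:
  "\<phi> (Poly_Mapping.single (\<Sum>i\<in>A. m i) 1) = (\<Prod>i\<in>A. \<phi> (Poly_Mapping.single (m i) 1))"
proof (induction A rule: infinite_finite_induct)
  case (insert i A)
  have "\<phi> (Poly_Mapping.single (m i) 1 * Poly_Mapping.single (sum m A) 1) =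
      \<phi> (Poly_Mapping.single (m i) 1) * \<phi> (Poly_Mapping.single (sum m A) 1)"
    using dbm unfolding double_bialgebra_morphism_def alg_morphism_def by blast
  then show ?case using insert by (simp add: mult_single)
qed (use morphism_one in simp_all)

lemma morphism_at_0: "poly (\<phi> (gen \<pi>)) 0 = 0"
  using dbm by (simp add: double_bialgebra_morphism_def counit_Delta_def alg_lift_gen)

lemma morphism_at_1: "poly (\<phi> (gen \<pi>)) 1 = (if card (blocks \<pi>) = 1 then 1 else 0)"
  using dbm by (simp add: double_bialgebra_morphism_def counit_delta_def alg_lift_gen)

end

section \<open>The character as a product of Catalan numbers\<close>

lemma is_ideal_remove_iff:
  "b \<in> blocks \<pi> \<Longrightarrow> is_ideal \<pi> (blocks \<pi> - {b}) \<longleftrightarrow> b \<in> outer (blocks \<pi>)"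
  by (auto simp: is_ideal_def outer_def)

text \<open>The ideals whose complement has at most one block are the whole partition and the complements of
outer blocks, since the one removed block must not be enclosed by another.\<close>

lemma sum_ideals_small_complement:
  assumes ncp: "noncrossing_partition n (blocks \<pi>)"
    and zero: "\<And>J. is_ideal \<pi> J \<Longrightarrow> card (blocks \<pi> - J) > 1 \<Longrightarrow> F J = 0"
  shows "(\<Sum>J | is_ideal \<pi> J. F J) = F (blocks \<pi>) + (\<Sum>b\<in>outer (blocks \<pi>). F (blocks \<pi> - {b}))"
proof -
  let ?P = "blocks \<pi>"
  let ?T = "(\<lambda>b. ?P - {b}) ` outer ?P"
  have finP: "finite ?P" by (rule finite_ncp[OF ncp])
  have sub: "outer ?P \<subseteq> ?P" by (auto simp: outer_def)
  have T: "insert ?P ?T \<subseteq> {J. is_ideal \<pi> J}"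
    using is_ideal_remove_iff sub by (auto simp: is_ideal_def)
  have "F J = 0" if J: "is_ideal \<pi> J" "J \<notin> insert ?P ?T" for J
  proof (rule zero[OF J(1)])
    have JP: "J \<subseteq> ?P" using J(1) by (simp add: is_ideal_def)
    have "card (?P - J) \<noteq> 0" using finP J(2) JP by auto
    moreover have "card (?P - J) \<noteq> 1"
    proof
      assume "card (?P - J) = 1"
      then obtain b where "?P - J = {b}" by (auto simp: card_1_singleton_iff)
      then have "J = ?P - {b}" "b \<in> ?P" using JP by auto
      then show False using J is_ideal_remove_iff by auto
    qed
    ultimately show "card (?P - J) > 1" by linarith
  qed
  moreover have "finite {J. is_ideal \<pi> J}"
    by (rule finite_subset[of _ "Pow ?P"]) (use finP in \<open>auto simp: is_ideal_def\<close>)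
  ultimately have "(\<Sum>J | is_ideal \<pi> J. F J) = (\<Sum>J\<in>insert ?P ?T. F J)"
    using T by (intro sum.mono_neutral_right) auto
  also have "\<dots> = F ?P + sum F ?T"
    using sub finP by (intro sum.insert) (auto intro: finite_subset)
  also have "sum F ?T = (\<Sum>b\<in>outer ?P. F (?P - {b}))"
    by (rule sum.reindex_cong[OF _ refl refl]) (use sub in \<open>auto simp: inj_on_def\<close>)
  finally show ?thesis .
qed

text \<open>Evaluation at \<open>1\<close> is the counit of \<open>\<delta>\<close>, which is one on partitions with a single block and
on the unit, and zero on partitions with several blocks. This is the mechanism that reduces the coproduct to the outer blocks.\<close>

lemma morphism_restrict_blocks_at_1:
  fixes \<phi> :: "'k::field_char_0 ncp_alg \<Rightarrow> 'k poly"
  assumes "double_bialgebra_morphism \<phi>" "Y \<subseteq> blocks \<pi>"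
  shows "poly (\<phi> (Poly_Mapping.single (restrict_blocks Y) 1)) 1 = (if card Y \<le> 1 then 1 else 0)"
proof (cases "Y = {}")
  case True
  moreover have "\<phi> 1 = 1" using morphism_one[OF assms(1)] by simp
  ultimately show ?thesis by (simp add: restrict_blocks_def)
next
  case False
  obtain n where ncp: "noncrossing_partition n (blocks \<pi>)" using ncp_noncrossing_partition by blast
  have "\<Union>Y \<subseteq> {1..n}" using assms(2) ncp_Union[OF ncp] by blast
  then have "finite (\<Union>Y)" by (rule finite_subset) simp
  moreover have "finite Y" using finite_ncp[OF ncp] assms(2) by (rule finite_subset[rotated])
  then have "card Y \<noteq> 0" using False by simp
  ultimately show ?thesis
    using False morphism_at_1[OF assms(1), of "Abs_ncp (renumber Y)"]
    by (simp add: restrict_blocks_def gen_def blocks_renumber[OF assms(2)] card_renumber)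
qed

text \<open>The coproduct evaluated at \<open>(1, -1)\<close> expresses the value at \<open>-1\<close> through partitions with fewer
blocks, by the same recursion that the weight satisfies.\<close>

lemma mu_eq_weight:
  fixes \<phi> :: "'k::field_char_0 ncp_alg \<Rightarrow> 'k poly"
  assumes dbm: "double_bialgebra_morphism \<phi>"
  shows "mu_ncp \<phi> (gen \<pi>) = weight (blocks \<pi>)"
proof (induction "card (blocks \<pi>)" arbitrary: \<pi> rule: less_induct)
  case less
  let ?P = "blocks \<pi>"
  let ?val = "\<lambda>m x. poly (\<phi> (Poly_Mapping.single m 1)) x"
  obtain n where ncp: "noncrossing_partition n ?P" using ncp_noncrossing_partition by blast
  have finP: "finite ?P" by (rule finite_ncp[OF ncp])
  define F where "F J = ?val (restrict_blocks (?P - J)) 1 * ?val (restrict_ideal J) (- 1)" for J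
  have one: "?val (restrict_blocks (?P - J)) 1 = (if card (?P - J) \<le> 1 then 1 else 0)" for J
    by (rule morphism_restrict_blocks_at_1[OF dbm]) auto
  \<comment> \<open>\<open>1\<close> is chosen because the counit of \<open>\<delta>\<close> makes the first factor of \<open>F\<close> trivial.\<close>
  have "0 = (\<Sum>J | is_ideal \<pi> J. F J)"
    using coproduct_evaluated[OF dbm, of \<pi> 1 "- 1"] morphism_at_0[OF dbm, of \<pi>] by (simp add: F_def)
  also have "\<dots> = F ?P + (\<Sum>b\<in>outer ?P. F (?P - {b}))"
    by (rule sum_ideals_small_complement[OF ncp]) (auto simp: F_def one)
  also have "F ?P = mu_ncp \<phi> (gen \<pi>)"
  proof -
    have U: "\<Union>?P = {1..n}" and n: "1 \<le> n"
      using ncp_Union[OF ncp] ncp by (auto simp: noncrossing_partition_def)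
    then have "?P \<noteq> {}" by auto
    moreover have "{c \<in> ?P. c \<subseteq> {1..n}} = ?P" using U by blast
    ultimately have "restrict_ideal ?P = {#\<pi>#}"
      unfolding restrict_ideal_def U runs_atLeastAtMost[OF n]
      by (simp add: restrict_blocks_def renumber_ncp[OF ncp] blocks_inverse)
    then show ?thesis using one[of ?P] by (simp add: F_def mu_ncp_def gen_def)
  qed
  also have "(\<Sum>b\<in>outer ?P. F (?P - {b})) = (\<Sum>b\<in>outer ?P. weight (?P - {b}))"
  proof (rule sum.cong[OF refl])
    fix b assume b: "b \<in> outer ?P"
    let ?J = "?P - {b}"
    have bP: "b \<in> ?P" using b by (auto simp: outer_def)
    have val: "?val (restrict_blocks {c \<in> ?J. c \<subseteq> I}) (- 1) = weight {c \<in> ?J. c \<subseteq> I}"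
      if I: "I \<in> runs (\<Union>?J)" for I
    proof -
      let ?Y = "{c \<in> ?J. c \<subseteq> I}"
      have UY: "\<Union>?Y = I" by (rule runs_remove_outer(1)[OF ncp b I])
      obtain u v where uv: "u \<le> v" "I = {u..v}" using I by (auto simp: runs_def)
      then have Y: "?Y \<noteq> {}" "?Y \<subseteq> ?P" using UY by auto
      have bl: "blocks (Abs_ncp (renumber ?Y)) = renumber ?Y" by (rule blocks_renumber[OF Y(2,1)])
      have "finite I" using uv by simp
      then have "card (renumber ?Y) = card ?Y" by (intro card_renumber) (simp only: UY)
      also have "card ?Y < card ?P" using bP finP by (intro psubset_card_mono) auto
      finally have "mu_ncp \<phi> (gen (Abs_ncp (renumber ?Y))) = weight (renumber ?Y)"
        using less[of "Abs_ncp (renumber ?Y)"] bl by simp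
      also have "\<dots> = weight ?Y"
        by (rule weight_renumber_interval[of _ u v]) (use UY uv ncp_block_nonempty[OF ncp] in auto)
      finally have "mu_ncp \<phi> (gen (Abs_ncp (renumber ?Y))) = weight ?Y" .
      moreover have "restrict_blocks ?Y = {#Abs_ncp (renumber ?Y)#}"
        unfolding restrict_blocks_def using Y(1) by (rule if_not_P)
      ultimately show ?thesis by (simp only: mu_ncp_def gen_def)
    qed
    have "?P - ?J = {b}" using bP by auto
    then have "F ?J = ?val (restrict_ideal ?J) (- 1)" using one[of ?J] by (simp add: F_def)
    also have "\<dots> = (\<Prod>I\<in>runs (\<Union>?J). ?val (restrict_blocks {c \<in> ?J. c \<subseteq> I}) (- 1))"
      by (simp only: restrict_ideal_def morphism_monomial_sum[OF dbm] poly_prod)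
    also have "\<dots> = (\<Prod>I\<in>runs (\<Union>?J). weight {c \<in> ?J. c \<subseteq> I})"
      by (intro prod.cong refl val)
    also have "\<dots> = weight ?J" by (rule runs_remove_outer(2)[OF ncp b, symmetric])
    finally show "F ?J = weight ?J" .
  qed
  finally show ?case using weight_recursion[OF ncp, where 'k = 'k] by (metis add_right_cancel)
qed

theorem proposition3p5:
  fixes \<phi> :: "'k::field_char_0 ncp_alg \<Rightarrow> 'k poly" and \<pi> :: ncp
  assumes "double_bialgebra_morphism \<phi>"
  shows "mu_ncp \<phi> (gen \<pi>) =
    (- 1) ^ card (blocks \<pi>) * (\<Prod>C\<in>blocks \<pi> // chain_rel \<pi>. catalan (card C))"
  by (simp add: mu_eq_weight[OF assms] weight_def chain_rel_eq_chained)

end
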